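(* Let $h: J\to[0,\infty)$ and $f:I\to(0,\infty)$. (i) If $h$ is superadditive and $f$ is $\mathrm{A_tA_h}$-convex, then for all $x,y,z\in I$ $$f\left(\frac{x+z}{2}\right)+f\left(\frac{y+z}{2}\right)+f\left(\frac{x+y}{2}\right)\le h(3/2)\, f\left(\frac{x+y+z}{3}\right)+h(1/2)\left[f(x)+f(y)+f(z)\right].$$ (ii) If $h$ is subadditive and $f$ is $\mathrm{A_tA_h}$-concave, then the reverse inequality ($\ge$) holds for all $x,y,z\in I$.
   Context: $I\subseteq(0,\infty)$ is an interval. $J$ is a real interval containing $(0,1)$ and the point $3/2$. The function $h:J\to[0,\infty)$ is such that $h(t)$ and $h(1-t)$ are never both zero. $h$ is superadditive (resp. subadditive) if $h(s+t)\ge h(s)+h(t)$ (resp. $\le$) whenever $s,t,s+t\in J$. A function $f:I\to(0,\infty)$ is $\mathrm{A_tA_h}$-convex if $$f(t\alpha+(1-t)\beta)\le h(t)f(\alpha)+h(1-t)f(\beta)$$ for all $\alpha,\beta\in I$ and all $t\in[0,1]$ with $t,1-t\in J$; it is $\mathrm{A_tA_h}$-concave if the reverse inequality ($\ge$) holds for all such $\alpha,\beta,t$. *)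

theory Defs
  imports "HOL-Analysis.Analysis"
begin

text \<open>Functions given on a subset of the reals are total functions here; every condition on them is
  restricted to the subset.\<close>

definition superadditive_on :: "real set \<Rightarrow> (real \<Rightarrow> real) \<Rightarrow> bool" where
  "superadditive_on J h \<longleftrightarrow> (\<forall>s t. s \<in> J \<longrightarrow> t \<in> J \<longrightarrow> s + t \<in> J \<longrightarrow> h s + h t \<le> h (s + t))"

definition subadditive_on :: "real set \<Rightarrow> (real \<Rightarrow> real) \<Rightarrow> bool" where
  "subadditive_on J h \<longleftrightarrow> (\<forall>s t. s \<in> J \<longrightarrow> t \<in> J \<longrightarrow> s + t \<in> J \<longrightarrow> h (s + t) \<le> h s + h t)"

text \<open>The endpoints \<open>t = 0\<close> and \<open>t = 1\<close> give a condition only when both 0 and 1 lie in \<open>J\<close>.\<close>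

definition AtAh_convex_on ::
    "real set \<Rightarrow> real set \<Rightarrow> (real \<Rightarrow> real) \<Rightarrow> (real \<Rightarrow> real) \<Rightarrow> bool" where
  "AtAh_convex_on I J h f \<longleftrightarrow>
    (\<forall>\<alpha>\<in>I. \<forall>\<beta>\<in>I. \<forall>t\<in>{0..1}. t \<in> J \<longrightarrow> 1 - t \<in> J \<longrightarrow>
      f (t * \<alpha> + (1 - t) * \<beta>) \<le> h t * f \<alpha> + h (1 - t) * f \<beta>)"

definition AtAh_concave_on ::
    "real set \<Rightarrow> real set \<Rightarrow> (real \<Rightarrow> real) \<Rightarrow> (real \<Rightarrow> real) \<Rightarrow> bool" where
  "AtAh_concave_on I J h f \<longleftrightarrow>
    (\<forall>\<alpha>\<in>I. \<forall>\<beta>\<in>I. \<forall>t\<in>{0..1}. t \<in> J \<longrightarrow> 1 - t \<in> J \<longrightarrow>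
      f (t * \<alpha> + (1 - t) * \<beta>) \<ge> h t * f \<alpha> + h (1 - t) * f \<beta>)"

end

theory Submission
  imports Defs
begin

text \<open>
  This is Popoviciu's inequality with the weights \<open>t\<close> and \<open>1 - t\<close> replaced by \<open>h t\<close> and \<open>h (1 - t)\<close>.
  Let \<open>m\<close> be the mean of \<open>x, y, z\<close>. The deviations \<open>x - m\<close>, \<open>y - m\<close>, \<open>z - m\<close> add up to 0, so if none
  of them vanishes then one, say \<open>z - m\<close>, has the sign opposite to that of the other two. In that case
  the midpoints \<open>(x + z)/2\<close> and \<open>(y + z)/2\<close> lie strictly between \<open>m\<close> and \<open>z\<close>, and their barycentric
  weights at \<open>m\<close> add up to 3/2, hence those at \<open>z\<close> to 1/2. Adding the two convexity inequalities to the
  one for the midpoint of \<open>x\<close> and \<open>y\<close>, and merging the values of \<open>h\<close> by superadditivity, gives the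
  claim (\<open>popoviciu_isolated\<close>).

  If one deviation vanishes, say \<open>y = m\<close>, the weights would be 1 and 1/2, but convexity with weights 1
  and 0 may be unavailable since 0 need not lie in \<open>J\<close>. What is needed there is only
  \<open>f m \<le> h 1 * f m\<close>, and this follows from convexity at the midpoint of \<open>m\<close> with itself together with
  \<open>h (1/2) + h (1/2) \<le> h 1\<close> (\<open>popoviciu_mean\<close>).

  Both parts of the theorem are instances of one inequality for a function \<open>F\<close> of arbitrary sign. The
  combination of super- or subadditivity of \<open>h\<close> with the sign of \<open>F\<close> is expressed by
  \<open>(h s + h t) * F p \<le> h (s + t) * F p\<close>, which holds for \<open>F = f\<close> in the convex and superadditive case
  and for \<open>F = - f\<close> in the concave and subadditive case.
\<close>

lemma AtAh_convex_onD:
  assumes "AtAh_convex_on I J h F" "{0<..<1} \<subseteq> J" "a \<in> I" "b \<in> I" "0 < t" "t < 1"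
  shows "F (t * a + (1 - t) * b) \<le> h t * F a + h (1 - t) * F b"
proof -
  have "t \<in> J" "1 - t \<in> J" using assms(2,5,6) by auto
  then show ?thesis using assms unfolding AtAh_convex_on_def by auto
qed

lemma AtAh_convex_on_midpoint:
  assumes "AtAh_convex_on I J h F" "{0<..<1} \<subseteq> J" "a \<in> I" "b \<in> I"
  shows "F ((a + b) / 2) \<le> h (1/2) * (F a + F b)"
  using AtAh_convex_onD[OF assms, of "1/2"] by (simp add: algebra_simps add_divide_distrib)

text \<open>The sign conditions make both weights at \<open>m\<close> lie strictly between 0 and 1, so that no convexity
  inequality at an endpoint is involved.\<close>

lemma popoviciu_isolated:
  fixes F :: "real \<Rightarrow> real"
  assumes convex: "AtAh_convex_on I J h F"
    and J: "{0<..<1} \<subseteq> J" "3/2 \<in> J"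
    and add: "\<And>s t p. s \<in> J \<Longrightarrow> t \<in> J \<Longrightarrow> s + t \<in> J \<Longrightarrow> p \<in> I \<Longrightarrow>
                (h s + h t) * F p \<le> h (s + t) * F p"
    and I: "x \<in> I" "y \<in> I" "z \<in> I" "m \<in> I"
    and m: "m = (x + y + z) / 3"
    and opposite: "(x - m) * (z - m) < 0" "(y - m) * (z - m) < 0"
  shows "F ((x + z) / 2) + F ((y + z) / 2) + F ((x + y) / 2)
           \<le> h (3/2) * F m + h (1/2) * (F x + F y + F z)"
proof -
  define s where "s = (z - x) / 2 / (z - m)"
  define t where "t = (z - y) / 2 / (z - m)"
  have nz: "z - m \<noteq> 0" using opposite by auto
  \<comment> \<open>In terms of \<open>r = (x - m) / (z - m)\<close> and \<open>q = (y - m) / (z - m)\<close>, which are negative with sum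
      \<open>-1\<close>, the weights are \<open>(1 - r) / 2\<close> and \<open>(1 - q) / 2\<close>.\<close>
  define r where "r = (x - m) / (z - m)"
  define q where "q = (y - m) / (z - m)"
  have neg: "r < 0" "q < 0"
    using opposite by (auto simp: r_def q_def divide_less_0_iff mult_less_0_iff)
  have "r + q = ((x - m) + (y - m)) / (z - m)"
    unfolding r_def q_def by (rule add_divide_distrib[symmetric])
  also have "(x - m) + (y - m) = - (z - m)" using m by simp
  finally have rq: "r + q = - 1" by (simp only: minus_divide_left[symmetric] divide_self[OF nz])
  have sr: "s = (1 - r) / 2" and tq: "t = (1 - q) / 2"
    using nz by (auto simp: s_def t_def r_def q_def field_simps)
  have s: "0 < s" "s < 1" and t: "0 < t" "t < 1" and st: "s + t = 3/2" "(1 - s) + (1 - t) = 1/2"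
    using neg rq unfolding sr tq by (simp_all add: field_simps)
  have inJ: "s \<in> J" "t \<in> J" "1 - s \<in> J" "1 - t \<in> J" "1/2 \<in> J"
    using J(1) s t by (auto intro!: subsetD[OF J(1)])
  have "s * (z - m) = (z - x) / 2" "t * (z - m) = (z - y) / 2"
    using s_def t_def unfolding nonzero_eq_divide_eq[OF nz] by auto
  then have mid: "s * m + (1 - s) * z = (x + z) / 2" "t * m + (1 - t) * z = (y + z) / 2"
    by (simp_all add: algebra_simps)
  have "F ((x + z) / 2) \<le> h s * F m + h (1 - s) * F z"
    using AtAh_convex_onD[OF convex J(1) I(4,3) s] mid by simp
  moreover have "F ((y + z) / 2) \<le> h t * F m + h (1 - t) * F z"
    using AtAh_convex_onD[OF convex J(1) I(4,3) t] mid by simp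
  moreover have "F ((x + y) / 2) \<le> h (1/2) * (F x + F y)"
    by (rule AtAh_convex_on_midpoint[OF convex J(1) I(1,2)])
  moreover have "(h s + h t) * F m \<le> h (3/2) * F m"
    using add[of s t m, unfolded st] inJ J(2) I by blast
  moreover have "(h (1 - s) + h (1 - t)) * F z \<le> h (1/2) * F z"
    using add[of "1 - s" "1 - t" z, unfolded st] inJ I by blast
  ultimately show ?thesis by (simp add: algebra_simps)
qed

text \<open>When \<open>y\<close> is the mean, \<open>F y \<le> h 1 * F y\<close> replaces the convexity inequality with weights 1 and 0.
  It also covers three equal points.\<close>

lemma popoviciu_mean:
  fixes F :: "real \<Rightarrow> real"
  assumes convex: "AtAh_convex_on I J h F"
    and J: "{0<..<1} \<subseteq> J" "1 \<in> J" "3/2 \<in> J"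
    and add: "\<And>s t p. s \<in> J \<Longrightarrow> t \<in> J \<Longrightarrow> s + t \<in> J \<Longrightarrow> p \<in> I \<Longrightarrow>
                (h s + h t) * F p \<le> h (s + t) * F p"
    and I: "x \<in> I" "y \<in> I" "z \<in> I"
    and y: "y = (x + z) / 2"
  shows "F ((x + z) / 2) + F ((y + z) / 2) + F ((x + y) / 2)
           \<le> h (3/2) * F y + h (1/2) * (F x + F y + F z)"
proof -
  have half: "1/2 \<in> J" using J(1) by auto
  have "F y \<le> h (1/2) * (F y + F y)"
    using AtAh_convex_on_midpoint[OF convex J(1) I(2,2)] by simp
  also have "\<dots> \<le> h 1 * F y"
    using add[of "1/2" "1/2" y] half J I by (simp add: algebra_simps)
  finally have "F y \<le> h 1 * F y" .
  moreover have "(h 1 + h (1/2)) * F y \<le> h (3/2) * F y"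
    using add[of 1 "1/2" y] half J I by simp
  moreover have "F ((x + y) / 2) \<le> h (1/2) * (F x + F y)"
    by (rule AtAh_convex_on_midpoint[OF convex J(1) I(1,2)])
  moreover have "F ((y + z) / 2) \<le> h (1/2) * (F y + F z)"
    by (rule AtAh_convex_on_midpoint[OF convex J(1) I(2,3)])
  ultimately show ?thesis unfolding y[symmetric] by (simp add: algebra_simps)
qed

lemma zero_sum_opposite_sign_cases:
  fixes a b c :: real
  assumes "a + b + c = 0"
  obtains "a = 0" | "b = 0" | "c = 0"
    | "a * c < 0" "b * c < 0" | "a * b < 0" "c * b < 0" | "b * a < 0" "c * a < 0"
  using assms by (smt (verit) mult_neg_pos mult_pos_neg)

text \<open>The inequality is symmetric in the three points, so permuting them reduces it to the two cases
  above.\<close>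

lemma popoviciu_AtAh_convex:
  fixes F :: "real \<Rightarrow> real"
  assumes convex: "AtAh_convex_on I J h F"
    and int: "is_interval I"
    and J: "{0<..<1} \<subseteq> J" "1 \<in> J" "3/2 \<in> J"
    and add: "\<And>s t p. s \<in> J \<Longrightarrow> t \<in> J \<Longrightarrow> s + t \<in> J \<Longrightarrow> p \<in> I \<Longrightarrow>
                (h s + h t) * F p \<le> h (s + t) * F p"
    and I: "x \<in> I" "y \<in> I" "z \<in> I"
  shows "F ((x + z) / 2) + F ((y + z) / 2) + F ((x + y) / 2)
           \<le> h (3/2) * F ((x + y + z) / 3) + h (1/2) * (F x + F y + F z)"
proof -
  define m where "m = (x + y + z) / 3"
  have m_perm: "m = (x + y + z) / 3" "m = (x + z + y) / 3" "m = (y + z + x) / 3"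
    by (simp_all add: m_def)
  have "min x (min y z) \<le> m" "m \<le> max x (max y z)"
    unfolding m_def by (auto simp: min_def max_def)
  moreover have "min x (min y z) \<in> I" "max x (max y z) \<in> I"
    using I by (auto simp: min_def max_def)
  ultimately have mI: "m \<in> I" using int mem_is_interval_1_I by blast
  have isolated: "F ((a + c) / 2) + F ((b + c) / 2) + F ((a + b) / 2)
      \<le> h (3/2) * F m + h (1/2) * (F a + F b + F c)"
    if "a \<in> I" "b \<in> I" "c \<in> I" "m = (a + b + c) / 3" "(a - m) * (c - m) < 0" "(b - m) * (c - m) < 0"
    for a b c
    using popoviciu_isolated[OF convex J(1,3) _ that(1-3) mI that(4-6)] add by blast
  note mean = popoviciu_mean[OF convex J add]
  have "(x - m) + (y - m) + (z - m) = 0" by (simp add: m_def field_simps)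
  then show ?thesis unfolding m_def[symmetric]
  proof (cases rule: zero_sum_opposite_sign_cases)
    case 1
    then have "x = m" "x = (y + z) / 2" by (auto simp: m_def field_simps)
    then show "F ((x + z) / 2) + F ((y + z) / 2) + F ((x + y) / 2)
        \<le> h (3/2) * F m + h (1/2) * (F x + F y + F z)"
      using mean[of y x z] I by (simp add: ac_simps)
  next
    case 2
    then have "y = m" "y = (x + z) / 2" by (auto simp: m_def field_simps)
    then show "F ((x + z) / 2) + F ((y + z) / 2) + F ((x + y) / 2)
        \<le> h (3/2) * F m + h (1/2) * (F x + F y + F z)"
      using mean[of x y z] I by (simp add: ac_simps)
  next
    case 3
    then have "z = m" "z = (x + y) / 2" by (auto simp: m_def field_simps)
    then show "F ((x + z) / 2) + F ((y + z) / 2) + F ((x + y) / 2)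
        \<le> h (3/2) * F m + h (1/2) * (F x + F y + F z)"
      using mean[of x z y] I by (simp add: ac_simps)
  next
    case 4
    then show "F ((x + z) / 2) + F ((y + z) / 2) + F ((x + y) / 2)
        \<le> h (3/2) * F m + h (1/2) * (F x + F y + F z)"
      using isolated[OF I(1,2,3) m_perm(1)] by (simp add: ac_simps)
  next
    case 5
    then show "F ((x + z) / 2) + F ((y + z) / 2) + F ((x + y) / 2)
        \<le> h (3/2) * F m + h (1/2) * (F x + F y + F z)"
      using isolated[OF I(1,3,2) m_perm(2)] by (simp add: ac_simps)
  next
    case 6
    then show "F ((x + z) / 2) + F ((y + z) / 2) + F ((x + y) / 2)
        \<le> h (3/2) * F m + h (1/2) * (F x + F y + F z)"
      using isolated[OF I(2,3,1) m_perm(3)] by (simp add: ac_simps)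
  qed
qed

theorem theorem2:
  fixes I J :: "real set" and h f :: "real \<Rightarrow> real"
  assumes "is_interval I" and "I \<subseteq> {0<..}"
    and "is_interval J" and "{0<..<1} \<subseteq> J" and "3/2 \<in> J"
    and "h \<in> J \<rightarrow> {0..}"
    and "\<And>t. t \<in> J \<Longrightarrow> 1 - t \<in> J \<Longrightarrow> \<not> (h t = 0 \<and> h (1 - t) = 0)"
    and "f \<in> I \<rightarrow> {0<..}"
  shows "(superadditive_on J h \<and> AtAh_convex_on I J h f \<longrightarrow>
            (\<forall>x\<in>I. \<forall>y\<in>I. \<forall>z\<in>I.
              f ((x + z) / 2) + f ((y + z) / 2) + f ((x + y) / 2)
                \<le> h (3/2) * f ((x + y + z) / 3) + h (1/2) * (f x + f y + f z)))
       \<and> (subadditive_on J h \<and> AtAh_concave_on I J h f \<longrightarrow>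
            (\<forall>x\<in>I. \<forall>y\<in>I. \<forall>z\<in>I.
              f ((x + z) / 2) + f ((y + z) / 2) + f ((x + y) / 2)
                \<ge> h (3/2) * f ((x + y + z) / 3) + h (1/2) * (f x + f y + f z)))"
proof -
  have "1/2 \<in> J" using assms(4) by auto
  then have one: "1 \<in> J"
    using mem_is_interval_1_I[OF assms(3) _ assms(5), of "1/2" 1] by simp
  have pos: "0 \<le> f p" if "p \<in> I" for p
    using assms(8) that by (auto simp: Pi_iff intro: less_imp_le)
  show ?thesis
  proof (intro conjI impI ballI; elim conjE)
    fix x y z
    assume xyz: "x \<in> I" "y \<in> I" "z \<in> I"
      and super: "superadditive_on J h" and convex: "AtAh_convex_on I J h f"
    have "(h s + h t) * f p \<le> h (s + t) * f p"
      if "s \<in> J" "t \<in> J" "s + t \<in> J" "p \<in> I" for s t p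
      using super that pos by (auto simp: superadditive_on_def intro: mult_right_mono)
    then show "f ((x + z) / 2) + f ((y + z) / 2) + f ((x + y) / 2)
        \<le> h (3/2) * f ((x + y + z) / 3) + h (1/2) * (f x + f y + f z)"
      by (rule popoviciu_AtAh_convex[OF convex assms(1,4) one assms(5) _ xyz])
  next
    fix x y z
    assume xyz: "x \<in> I" "y \<in> I" "z \<in> I"
      and sub: "subadditive_on J h" and concave: "AtAh_concave_on I J h f"
    have convex: "AtAh_convex_on I J h (\<lambda>p. - f p)"
      using concave by (fastforce simp: AtAh_convex_on_def AtAh_concave_on_def)
    have "(h s + h t) * - f p \<le> h (s + t) * - f p"
      if "s \<in> J" "t \<in> J" "s + t \<in> J" "p \<in> I" for s t p
      using sub that pos by (auto simp: subadditive_on_def intro: mult_right_mono)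
    from popoviciu_AtAh_convex[OF convex assms(1,4) one assms(5) this xyz]
    show "h (3/2) * f ((x + y + z) / 3) + h (1/2) * (f x + f y + f z)
        \<le> f ((x + z) / 2) + f ((y + z) / 2) + f ((x + y) / 2)"
      by (simp add: algebra_simps)
  qed
qed

end
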